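(* Let $F \colon \mathbb{R}^n \times \mathbb{R}^m \to \mathbb{R}^n$ be $C^1$, let $0 \leq \rho < 1$, and let $\mathcal{X} \subset \mathbb{R}^n$ be nonempty, convex and closed, such that for every $\theta \in \mathbb{R}^m$ one has $F_\theta(\mathcal{X}) \subset \mathcal{X}$ and $\|J_x F(x,\theta)\|_{\mathrm{op}} \leq \rho$ for all $x \in \mathcal{X}$. Assume moreover that there are constants $L_F, L_J \geq 0$ such that for every $x \in \mathbb{R}^n$ the map $\theta \mapsto F(x,\theta)$ is $L_F$-Lipschitz, and for every $\theta \in \mathbb{R}^m$ the map $x \mapsto J_\theta F(x,\theta)$ is $L_J$-Lipschitz on $\mathbb{R}^n$ (in operator norm). Then, for all $\theta \in \mathbb{R}^m$ and all $k \geq 1$, $$\|J^{\mathrm{OS}} x_k(\theta) - J_\theta \bar{x}(\theta)\|_{\mathrm{op}} \leq \frac{\rho L_F}{1 - \rho} + L_J \|x_{k-1}(\theta) - \bar{x}(\theta)\|.$$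
   Context: Write $F_\theta \colon x \mapsto F(x,\theta)$. $J_x F(x,\theta) \in \mathbb{R}^{n\times n}$ and $J_\theta F(x,\theta) \in \mathbb{R}^{n \times m}$ denote the partial Jacobian matrices of $F$ with respect to its first and second variable. $\|\cdot\|$ is the Euclidean norm and $\|\cdot\|_{\mathrm{op}}$ the induced operator norm. The iterates are defined by $x_0(\theta) \in \mathbb{R}^n$ and $x_{k+1}(\theta) = F(x_k(\theta),\theta)$ for $k \geq 0$. Under the stated hypotheses on $F$ and $\mathcal{X}$, for each $\theta \in \mathbb{R}^m$ the map $F_\theta$ has a unique fixed point in $\mathcal{X}$, denoted $\bar{x}(\theta)$, and $\theta \mapsto \bar{x}(\theta)$ is $C^1$, with Jacobian $J_\theta \bar{x}(\theta)$. The one-step estimator is defined, for $k \geq 1$, as $J^{\mathrm{OS}} x_k(\theta) := J_\theta F(x_{k-1}(\theta), \theta)$, i.e. the partial Jacobian of $F$ in its second variable evaluated at the point $(x_{k-1}(\theta),\theta)$ (the dependence of $x_{k-1}$ on $\theta$ is not differentiated). *)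

theory Defs
  imports "HOL-Analysis.Analysis"
begin

definition C1_map :: "('a::real_normed_vector \<Rightarrow> 'b::real_normed_vector) \<Rightarrow> bool" where
  "C1_map f \<longleftrightarrow>
     (\<exists>f'. (\<forall>z. (f has_derivative blinfun_apply (f' z)) (at z)) \<and> continuous_on UNIV f')"

(* The library instance of norm on real ^ 'q ^ 'p is the Frobenius norm,
   not the norm induced by the Euclidean norms. *)
definition opnorm :: "real ^ 'q ^ 'p \<Rightarrow> real" where
  "opnorm A = onorm ((*v) A)"

definition Jx :: "((real ^ 'n) \<times> (real ^ 'm) \<Rightarrow> real ^ 'n) \<Rightarrow> real ^ 'n \<Rightarrow> real ^ 'm \<Rightarrow> real ^ 'n ^ 'n" where
  "Jx F x \<theta> = jacobian (\<lambda>y. F (y, \<theta>)) (at x)"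

definition J\<theta> :: "((real ^ 'n) \<times> (real ^ 'm) \<Rightarrow> real ^ 'n) \<Rightarrow> real ^ 'n \<Rightarrow> real ^ 'm \<Rightarrow> real ^ 'm ^ 'n" where
  "J\<theta> F x \<theta> = jacobian (\<lambda>t. F (x, t)) (at \<theta>)"

primrec iterate ::
  "((real ^ 'n) \<times> (real ^ 'm) \<Rightarrow> real ^ 'n) \<Rightarrow> (real ^ 'm \<Rightarrow> real ^ 'n) \<Rightarrow> nat \<Rightarrow> real ^ 'm \<Rightarrow> real ^ 'n"
where
  "iterate F x0 0 \<theta> = x0 \<theta>"
| "iterate F x0 (Suc k) \<theta> = F (iterate F x0 k \<theta>, \<theta>)"

(* Well defined when X is nonempty, closed and mapped into itself by the contraction
   F (_, \<theta>), by Banach's theorem; arbitrary otherwise. *)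
definition fixpt ::
  "((real ^ 'n) \<times> (real ^ 'm) \<Rightarrow> real ^ 'n) \<Rightarrow> (real ^ 'n) set \<Rightarrow> real ^ 'm \<Rightarrow> real ^ 'n" where
  "fixpt F X \<theta> = (THE x. x \<in> X \<and> F (x, \<theta>) = x)"

(* Meaningful for k \<ge> 1 only: the subtraction truncates at k = 0. *)
definition J_OS ::
  "((real ^ 'n) \<times> (real ^ 'm) \<Rightarrow> real ^ 'n) \<Rightarrow> (real ^ 'm \<Rightarrow> real ^ 'n) \<Rightarrow> nat \<Rightarrow> real ^ 'm \<Rightarrow> real ^ 'm ^ 'n"
where
  "J_OS F x0 k \<theta> = J\<theta> F (iterate F x0 (k - 1) \<theta>) \<theta>"

end

theory Submission
  imports Defs
begin

text \<open>
  By the mean value inequality, \<open>F (_, \<theta>)\<close> is a \<open>\<rho>\<close>-contraction of \<open>X\<close>, and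
  \<open>L\<^sub>F\<close>-Lipschitz dependence on \<open>\<theta>\<close> makes the fixed point \<open>L\<^sub>F / (1 - \<rho>)\<close>-Lipschitz.
  Let \<open>A\<close> and \<open>B\<close> be the partial derivatives of \<open>F\<close> at the fixed point. The Lipschitz bound turns the
  first-order expansion of the fixed-point equation into
  \<open>(I - A) (fixpt F X \<theta>' - fixpt F X \<theta>) = B (\<theta>' - \<theta>) + o(norm (\<theta>' - \<theta>))\<close>; since \<open>I - A\<close> is invertible, the fixed
  point has a derivative \<open>D = A D + B\<close> with \<open>onorm D \<le> L\<^sub>F / (1 - \<rho>)\<close>. Hence
  \<open>B - D = - A D\<close> accounts for the first term of the bound, and the \<open>L\<^sub>J\<close>-Lipschitz continuity of
  the partial Jacobian in \<open>x\<close> for the second.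
\<close>

text \<open>\<open>jacobian\<close> is the matrix of a derivative picked by choice; uniqueness of
  derivatives identifies it with the given \<open>f'\<close>. All later estimates can then use
  linear maps and \<open>onorm\<close> instead of matrices.\<close>

lemma jacobian_mult_vector:
  fixes f :: "real ^ 'a \<Rightarrow> real ^ 'b"
  assumes "(f has_derivative f') (at x)"
  shows "jacobian f (at x) *v h = f' h"
  using assms
  by (simp add: jacobian_def frechet_derivative_at[symmetric] has_derivative_linear matrix_works)

lemma opnorm_jacobian:
  fixes f :: "real ^ 'a \<Rightarrow> real ^ 'b"
  assumes "(f has_derivative f') (at x)"
  shows "opnorm (jacobian f (at x)) = onorm f'"
  unfolding opnorm_def using jacobian_mult_vector[OF assms] by presburger

lemma opnorm_triangle:
  fixes A B :: "real ^ 'a ^ 'b"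
  shows "opnorm (A + B) \<le> opnorm A + opnorm B"
  unfolding opnorm_def matrix_vector_mult_add_rdistrib
  by (intro onorm_triangle matrix_vector_mul_bounded_linear)

text \<open>On a short enough step along \<open>h\<close>, the increment of \<open>f\<close> is at
  most \<open>C\<close> times the step length and differs from its linear part by at most
  \<open>e\<close> times that length. Linearity rescales the step to \<open>h\<close>, and
  \<open>e\<close> is arbitrary.\<close>

lemma onorm_derivative_le_lipschitz:
  fixes f :: "'a::real_normed_vector \<Rightarrow> 'b::real_normed_vector"
  assumes lip: "C-lipschitz_on UNIV f" and der: "(f has_derivative f') (at x)"
  shows "onorm f' \<le> C"
proof (rule onorm_bound)
  show "0 \<le> C" using lip by (rule lipschitz_on_nonneg)
  interpret bounded_linear f' using der by (rule has_derivative_bounded_linear)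
  fix h
  show "norm (f' h) \<le> C * norm h"
  proof (cases "h = 0")
    case False
    have "norm (f' h) / norm h \<le> C + e" if "e > 0" for e
    proof -
      obtain d where d: "d > 0"
        "\<And>y. norm (y - x) < d \<Longrightarrow> norm (f y - f x - f' (y - x)) \<le> e * norm (y - x)"
        using der \<open>e > 0\<close> unfolding has_derivative_at_alt by blast
      \<comment> \<open>The step \<open>t *\<^sub>R h\<close> has length \<open>d / 2\<close>,
        inside the ball where the expansion holds.\<close>
      define t where "t = d / (2 * norm h)"
      have t: "t > 0" "norm (t *\<^sub>R h) < d" using d False by (auto simp: t_def)
      let ?y = "x + t *\<^sub>R h"
      have "norm (f' (t *\<^sub>R h)) \<le> norm (f ?y - f x) + norm (f ?y - f x - f' (t *\<^sub>R h))"
        by (metis add_diff_cancel_left' diff_diff_eq2 norm_triangle_ineq4 diff_add_cancel)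
      also have "norm (f ?y - f x) \<le> C * norm (t *\<^sub>R h)"
        using lipschitz_onD[OF lip, of ?y x] by (simp add: dist_norm)
      also have "norm (f ?y - f x - f' (t *\<^sub>R h)) \<le> e * norm (t *\<^sub>R h)"
        using d(2)[of ?y] t by simp
      finally have "t * norm (f' h) \<le> t * ((C + e) * norm h)"
        using t by (simp add: scaleR algebra_simps)
      then have "norm (f' h) \<le> (C + e) * norm h"
        using t by simp
      then show ?thesis using False by (simp add: divide_simps)
    qed
    then have "norm (f' h) / norm h \<le> C" by (rule field_le_epsilon)
    then show ?thesis using False by (simp add: divide_simps)
  qed (simp add: zero)
qed

lemma has_derivative_partial_fst:
  assumes "(F has_derivative F') (at (x, t))"
  shows "((\<lambda>y. F (y, t)) has_derivative (\<lambda>h. F' (h, 0))) (at x within S)"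
  by (rule has_derivative_compose[OF has_derivative_Pair[OF has_derivative_ident has_derivative_const] assms])

lemma has_derivative_partial_snd:
  assumes "(F has_derivative F') (at (x, t))"
  shows "((\<lambda>s. F (x, s)) has_derivative (\<lambda>h. F' (0, h))) (at t within S)"
  by (rule has_derivative_compose[OF has_derivative_Pair[OF has_derivative_const has_derivative_ident] assms])

text \<open>Pass through the intermediate point \<open>F (g t, s)\<close>: contraction bounds one
  half, Lipschitz dependence on the parameter the other, and the \<open>\<rho>\<close> term is
  absorbed on the left.\<close>

lemma lipschitz_fixpoint:
  fixes g :: "'b::metric_space \<Rightarrow> 'a::metric_space"
  assumes "\<rho> < 1" "0 \<le> L"
    and fp: "\<And>t. g t = F (g t, t)" and gX: "\<And>t. g t \<in> X"
    and contr: "\<And>t. \<rho>-lipschitz_on X (\<lambda>x. F (x, t))"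
    and lip: "\<And>x. L-lipschitz_on UNIV (\<lambda>t. F (x, t))"
  shows "(L / (1 - \<rho>))-lipschitz_on UNIV g"
proof (rule lipschitz_onI)
  fix s t
  have "dist (g s) (g t) \<le> dist (F (g s, s)) (F (g t, s)) + dist (F (g t, s)) (F (g t, t))"
    using dist_triangle fp by metis
  also have "\<dots> \<le> \<rho> * dist (g s) (g t) + L * dist s t"
    using lipschitz_onD[OF contr gX gX] lipschitz_onD[OF lip] by (intro add_mono) auto
  finally show "dist (g s) (g t) \<le> L / (1 - \<rho>) * dist s t"
    using \<open>\<rho> < 1\<close> by (simp add: field_simps)
qed (use assms in auto)

text \<open>The derivative is \<open>T\<close> applied to the parameter part of \<open>F'\<close>,
  where \<open>T\<close> inverts \<open>I - A\<close> and \<open>A\<close> is the state part of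
  \<open>F'\<close>.\<close>

lemma has_derivative_fixpoint:
  fixes F :: "'a::euclidean_space \<times> 'b::real_normed_vector \<Rightarrow> 'a"
  assumes der: "(F has_derivative F') (at (g t, t))"
    and A: "onorm (\<lambda>h. F' (h, 0)) < 1"
    and fp: "\<And>s. g s = F (g s, s)"
    and lip: "C-lipschitz_on UNIV g"
  obtains D where "(g has_derivative D) (at t)" "\<And>h. D h = F' (D h, 0) + F' (0, h)"
proof -
  interpret F': bounded_linear F' using der by (rule has_derivative_bounded_linear)
  have blA: "bounded_linear (\<lambda>h. F' (h, 0))"
    by (rule has_derivative_bounded_linear[OF has_derivative_partial_fst[OF der]])
  have blB: "bounded_linear (\<lambda>h. F' (0, h))"
    by (rule has_derivative_bounded_linear[OF has_derivative_partial_snd[OF der]])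
  define M where "M = (\<lambda>h. h - F' (h, 0))"
  have blM: "bounded_linear M"
    unfolding M_def by (intro bounded_linear_sub bounded_linear_ident blA)
  interpret M: bounded_linear M by (rule blM)
  \<comment> \<open>A kernel vector of \<open>M\<close> is fixed by \<open>A\<close>, but
    \<open>A\<close> strictly shrinks nonzero vectors. In finite dimension injectivity yields the
    two-sided inverse \<open>T\<close>.\<close>
  have "inj M"
  proof (unfold linear_injective_0[OF M.linear], intro allI impI)
    fix h assume "M h = 0"
    then have "norm h \<le> onorm (\<lambda>h. F' (h, 0)) * norm h"
      using onorm[OF blA, of h] by (simp add: M_def)
    then show "h = 0" using A
      by (metis mult_less_cancel_right2 not_le norm_le_zero_iff)
  qed
  then obtain T where "linear T" and T: "\<And>h. T (M h) = h" "\<And>h. M (T h) = h"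
    using linear_injective_isomorphism[OF M.linear] by auto
  then interpret T: bounded_linear T by (simp add: linear_conv_bounded_linear)
  obtain K where K: "K > 0" "\<And>h. norm (T h) \<le> norm h * K" using T.pos_bounded by auto
  have C: "C \<ge> 0" using lip by (rule lipschitz_on_nonneg)
  let ?D = "\<lambda>h. T (F' (0, h))"
  have split: "F' (a, b) = F' (a, 0) + F' (0, b)" for a b
    by (simp flip: F'.add)
  have "(g has_derivative ?D) (at t)"
    unfolding has_derivative_at_alt
  proof (intro conjI allI impI)
    show "bounded_linear ?D" by (rule bounded_linear_compose[OF T.bounded_linear_axioms blB])
    fix e :: real assume "e > 0"
    \<comment> \<open>The final estimate loses a factor \<open>K\<close> from applying
      \<open>T\<close> and a factor \<open>C + 1\<close> from bounding the increment of
      \<open>(g s, s)\<close> by that of \<open>s\<close>.\<close>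
    define e' where "e' = e / (K * (C + 1))"
    have "e' > 0" using \<open>e > 0\<close> K C by (simp add: e'_def)
    then obtain d where d: "d > 0" "\<And>z. norm (z - (g t, t)) < d \<Longrightarrow>
        norm (F z - F (g t, t) - F' (z - (g t, t))) \<le> e' * norm (z - (g t, t))"
      using der unfolding has_derivative_at_alt by blast
    have "norm (g s - g t - ?D (s - t)) \<le> e * norm (s - t)" if s: "norm (s - t) < d / (C + 1)" for s
    proof -
      let ?z = "(g s, s)"
      have z: "norm (?z - (g t, t)) \<le> (C + 1) * norm (s - t)"
        using norm_Pair_le[of "g s - g t" "s - t"] lipschitz_onD[OF lip, of s t]
        by (simp add: dist_norm algebra_simps)
      also have "\<dots> < d" using s C by (simp add: field_simps)
      finally have r: "norm (F ?z - F (g t, t) - F' (?z - (g t, t))) \<le> e' * norm (?z - (g t, t))"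
        by (rule d(2))
      \<comment> \<open>By the two fixed-point equations, the remainder of \<open>g\<close> is
        exactly \<open>T\<close> applied to the remainder of \<open>F\<close>.\<close>
      have "g s - g t - ?D (s - t) = T (M (g s - g t) - F' (0, s - t))"
        by (simp add: T.diff T)
      also have "M (g s - g t) - F' (0, s - t) = F ?z - F (g t, t) - F' (?z - (g t, t))"
        using fp[of s] fp[of t] split[of "g s - g t" "s - t"] by (simp add: M_def)
      finally have "norm (g s - g t - ?D (s - t))
          \<le> norm (F ?z - F (g t, t) - F' (?z - (g t, t))) * K"
        using K(2) by metis
      also have "\<dots> \<le> (e' * ((C + 1) * norm (s - t))) * K"
        using r z \<open>e' > 0\<close> K(1) by (meson mult_left_mono mult_right_mono order_trans less_imp_le)
      also have "\<dots> = e * norm (s - t)" using K C by (simp add: e'_def)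
      finally show ?thesis .
    qed
    moreover have "d / (C + 1) > 0" using d C by simp
    ultimately show "\<exists>d>0. \<forall>s. norm (s - t) < d \<longrightarrow>
        norm (g s - g t - ?D (s - t)) \<le> e * norm (s - t)" by blast
  qed
  moreover have "?D h = F' (?D h, 0) + F' (0, h)" for h
    using T(2)[of "F' (0, h)"] by (simp add: M_def algebra_simps)
  ultimately show ?thesis by (rule that)
qed

lemma fixpt_is_fixpoint:
  assumes "\<rho> < 1" "X \<noteq> {}" "closed X"
    and "(\<lambda>x. F (x, \<theta>)) ` X \<subseteq> X"
    and "\<rho>-lipschitz_on X (\<lambda>x. F (x, \<theta>))"
  shows "fixpt F X \<theta> \<in> X" "F (fixpt F X \<theta>, \<theta>) = fixpt F X \<theta>"
proof -
  have "\<exists>!x. x \<in> X \<and> F (x, \<theta>) = x"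
    using Banach_fix[of X \<rho> "\<lambda>x. F (x, \<theta>)"] assms lipschitz_on_nonneg[OF assms(5)]
      lipschitz_onD[OF assms(5)]
    by (auto simp: complete_eq_closed)
  from theI'[OF this] show "fixpt F X \<theta> \<in> X" "F (fixpt F X \<theta>, \<theta>) = fixpt F X \<theta>"
    by (auto simp: fixpt_def)
qed

theorem corollary1:
  fixes F :: "(real ^ 'n) \<times> (real ^ 'm) \<Rightarrow> real ^ 'n"
    and X :: "(real ^ 'n) set"
    and x0 :: "real ^ 'm \<Rightarrow> real ^ 'n"
    and \<rho> L\<^sub>F L\<^sub>J :: real
  assumes "C1_map F"
    and "0 \<le> \<rho>" and "\<rho> < 1"
    and "X \<noteq> {}" and "convex X" and "closed X"
    and "\<And>\<theta>. (\<lambda>x. F (x, \<theta>)) ` X \<subseteq> X"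
    and "\<And>x \<theta>. x \<in> X \<Longrightarrow> opnorm (Jx F x \<theta>) \<le> \<rho>"
    and "0 \<le> L\<^sub>F" and "0 \<le> L\<^sub>J"
    and "\<And>x. L\<^sub>F-lipschitz_on UNIV (\<lambda>\<theta>. F (x, \<theta>))"
    and "\<And>\<theta> x y. opnorm (J\<theta> F x \<theta> - J\<theta> F y \<theta>) \<le> L\<^sub>J * norm (x - y)"
  shows "\<forall>\<theta>. \<forall>k\<ge>1.
    opnorm (J_OS F x0 k \<theta> - jacobian (fixpt F X) (at \<theta>))
      \<le> \<rho> * L\<^sub>F / (1 - \<rho>) + L\<^sub>J * norm (iterate F x0 (k - 1) \<theta> - fixpt F X \<theta>)"
proof (intro allI impI)
  fix \<theta> :: "real ^ 'm" and k :: nat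
  obtain F' where F': "\<And>z. (F has_derivative blinfun_apply (F' z)) (at z)"
    using assms(1) unfolding C1_map_def by blast
  note dx = has_derivative_partial_fst[OF F'] and dt = has_derivative_partial_snd[OF F']
  have A: "onorm (\<lambda>h. F' (x, t) (h, 0)) \<le> \<rho>" if "x \<in> X" for x t
    using assms(8)[OF that, of t] by (simp add: Jx_def opnorm_jacobian[OF dx])
  \<comment> \<open>Mean value inequality on the convex set \<open>X\<close>, where the derivative
    bound \<open>A\<close> holds.\<close>
  have contr: "\<rho>-lipschitz_on X (\<lambda>x. F (x, t))" for t
    using differentiable_bound[OF assms(5) dx A] assms(2)
    by (auto intro!: lipschitz_onI simp: dist_norm)
  let ?g = "fixpt F X"
  have gX: "?g t \<in> X" and fp: "?g t = F (?g t, t)" for t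
    using fixpt_is_fixpoint[OF assms(3,4,6,7) contr, of t] by auto
  have lip: "(L\<^sub>F / (1 - \<rho>))-lipschitz_on UNIV ?g"
    by (rule lipschitz_fixpoint[OF assms(3,9) fp gX contr assms(11)])
  obtain D where D: "(?g has_derivative D) (at \<theta>)"
      and D_eq: "\<And>h. D h = F' (?g \<theta>, \<theta>) (D h, 0) + F' (?g \<theta>, \<theta>) (0, h)"
    using has_derivative_fixpoint[OF F' le_less_trans[OF A[OF gX] assms(3)] fp lip] by blast
  let ?A = "\<lambda>h. F' (?g \<theta>, \<theta>) (h, 0)"
  let ?x = "iterate F x0 (k - 1) \<theta>"
  \<comment> \<open>At the fixed point the one-step estimator omits only \<open>A D\<close>, of norm
    at most \<open>\<rho>\<close> times the Lipschitz constant of the fixed point.\<close>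
  have "(J\<theta> F (?g \<theta>) \<theta> - jacobian ?g (at \<theta>)) *v h = - ?A (D h)" for h
    using D_eq[of h]
    by (simp add: J\<theta>_def matrix_vector_mult_diff_rdistrib jacobian_mult_vector[OF dt]
        jacobian_mult_vector[OF D] algebra_simps)
  then have "(*v) (J\<theta> F (?g \<theta>) \<theta> - jacobian ?g (at \<theta>)) = (\<lambda>h. - ?A (D h))"
    by (rule ext)
  then have "opnorm (J\<theta> F (?g \<theta>) \<theta> - jacobian ?g (at \<theta>)) = onorm (?A \<circ> D)"
    by (simp only: opnorm_def onorm_neg comp_def)
  also have "\<dots> \<le> onorm ?A * onorm D"
    by (intro onorm_compose has_derivative_bounded_linear[OF dx] has_derivative_bounded_linear[OF D])
  also have "\<dots> \<le> \<rho> * (L\<^sub>F / (1 - \<rho>))"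
    using A[OF gX] onorm_derivative_le_lipschitz[OF lip D] assms(2)
    by (intro mult_mono onorm_pos_le has_derivative_bounded_linear[OF D])
  finally have "opnorm (J\<theta> F (?g \<theta>) \<theta> - jacobian ?g (at \<theta>)) \<le> \<rho> * L\<^sub>F / (1 - \<rho>)"
    by simp
  moreover have "opnorm (J_OS F x0 k \<theta> - J\<theta> F (?g \<theta>) \<theta>) \<le> L\<^sub>J * norm (?x - ?g \<theta>)"
    unfolding J_OS_def by (rule assms(12))
  \<comment> \<open>The error splits at \<open>J\<theta> F (?g \<theta>) \<theta>\<close>, the
    estimator evaluated at the limit point.\<close>
  ultimately show "opnorm (J_OS F x0 k \<theta> - jacobian ?g (at \<theta>))
      \<le> \<rho> * L\<^sub>F / (1 - \<rho>) + L\<^sub>J * norm (?x - ?g \<theta>)"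
    using opnorm_triangle[of "J_OS F x0 k \<theta> - J\<theta> F (?g \<theta>) \<theta>" "J\<theta> F (?g \<theta>) \<theta> - jacobian ?g (at \<theta>)"]
    by simp
qed

end
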